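(* Let $f:\mathbb{R}^d\to\mathbb{R}\cup\{\infty\}$ be convex and $\ell$-smooth, attaining its minimum at $x^*\in\mathbb{R}^d$, and let $x^0\in\mathcal{X}$ with $R:=\|x^0-x^*\|>0$. Suppose that $\psi:\mathbb{R}_+\to\mathbb{R}_+$, $\psi(x)=\frac{x^2}{2\ell(4x)}$, is strictly increasing. Let $\varepsilon>0$. Then, taking $\bar R=R$ and choosing $\delta$ to minimize $k(\delta)$ below, the oracle complexity (number of gradient calls) required by Algorithm 1 to find an $\varepsilon$-solution is at most (rounded up to an integer) $$\frac{5\sqrt{\ell(0)}\,R}{\sqrt{\varepsilon}}+\min_{\delta\ge 0\,:\,\ell\left(8\sqrt{\delta\,\ell(0)}\right)\le 2\ell(0)}k(\delta),\qquad k(\delta):=\max\left\{1+\frac12\log_{3/2}\left(\frac{\delta}{8\ell(0)R^2}\right),0\right\}+k_{\mathrm{GD}}(\delta),$$ where $k_{\mathrm{GD}}(\delta)$ is the oracle complexity of GD (Phase 1 of Algorithm 1, started at $x^0$) for finding a point $\bar x$ such that $f(\bar x)-f(x^* )\le\delta/2$; the second term does not depend on $\varepsilon$.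
   Context: $\|\cdot\|$ is the Euclidean norm for vectors and the spectral norm for matrices; $\mathbb{R}_+=[0,\infty)$. An $\varepsilon$-solution is a point $\bar x\in\mathbb{R}^d$ with $f(\bar x)-\inf_{x} f(x)\le\varepsilon$. Setting: $f:\mathbb{R}^d\to\mathbb{R}\cup\{\infty\}$, $\mathcal{X}:=\{x\in\mathbb{R}^d: f(x)<\infty\}$ is assumed to be an open, $d$-dimensional (nonempty) convex set, and $\bar{\mathcal{X}}$ denotes its closure; $\mathrm{Proj}_{\bar{\mathcal{X}}}$ is the Euclidean projection onto $\bar{\mathcal{X}}$. $f$ is $\ell$-smooth if $f$ is twice differentiable on $\mathcal{X}$, continuous on $\bar{\mathcal{X}}$, and $\ell:[0,\infty)\to(0,\infty)$ is a non-decreasing, positive, locally Lipschitz function with $\|\nabla^2 f(x)\|\le \ell(\|\nabla f(x)\|)$ for all $x\in\mathcal{X}$. Algorithm 1 (input: $x^0\in\mathcal{X}$, $\ell$, $\delta$, $\bar R$). Phase 1: starting from $x^0$, run gradient descent (GD) $x^{j+1}=x^j-\eta_j\nabla f(x^j)$ with $\eta_j=\int_0^1\frac{dv}{\ell(\|\nabla f(x^j)\|+\|\nabla f(x^j)\|v)}$ until a point $\bar x$ with $f(\bar x)-f(x^* )\le\delta/2$ is reached. Phase 2: set $y^0=u^0=\bar x$, $\Gamma_0=\delta/\bar R^2$, $\gamma=1/(2\ell(0))$, and for $k=0,1,2,\dots$: $\alpha_k=\sqrt{\gamma\Gamma_k}$; $y^{k+1}=\frac{1}{1+\alpha_k}y^k+\frac{\alpha_k}{1+\alpha_k}u^k-\frac{\gamma}{1+\alpha_k}\nabla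 f(y^k)$; $u^{k+1}=\mathrm{Proj}_{\bar{\mathcal{X}}}\left(u^k-\frac{\alpha_k}{\Gamma_k}\nabla f(y^{k+1})\right)$; $\Gamma_{k+1}=\Gamma_k/(1+\alpha_k)$. One new gradient is computed per iteration. Conventions for the degenerate value $\delta=0$: $\log 0=-\infty$, $k_{\mathrm{GD}}(0)=\infty$ if GD does not reach a minimizer in finitely many steps, and if it does, the point $\bar x$ is already an $\varepsilon$-solution. *)

theory Defs
  imports "HOL-Analysis.Analysis"
begin

definition effdom :: "('a \<Rightarrow> ereal) \<Rightarrow> 'a set" where
  "effdom f = {x. f x < \<infinity>}"

(* With 0 * \<infinity> = 0 in ereal and f x \<noteq> -\<infinity>, no indeterminate form arises on the right-hand side. *)
definition convex_ext :: "('a::real_vector \<Rightarrow> ereal) \<Rightarrow> bool" where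
  "convex_ext f \<longleftrightarrow> (\<forall>x y. \<forall>t\<in>{0..1::real}.
     f ((1 - t) *\<^sub>R x + t *\<^sub>R y) \<le> ereal (1 - t) * f x + ereal t * f y)"

(* Only meaningful at points of effdom f where f is differentiable. *)
definition gradient :: "('a::euclidean_space \<Rightarrow> ereal) \<Rightarrow> 'a \<Rightarrow> 'a" where
  "gradient f x = (THE g. GDERIV (\<lambda>z. real_of_ereal (f z)) x :> g)"

definition hessian :: "('a::euclidean_space \<Rightarrow> ereal) \<Rightarrow> 'a \<Rightarrow> 'a \<Rightarrow> 'a" where
  "hessian f x = frechet_derivative (gradient f) (at x)"

(* onorm of the Hessian as a linear map is the spectral norm of its matrix.  Continuity on the
   closure is that of an ereal-valued map, so f tends to \<infinity> at boundary points outside effdom f.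
   The index set UNIV of local_lipschitz is a dummy: its maps do not depend on the index. *)
definition ell_smooth :: "(real \<Rightarrow> real) \<Rightarrow> ('a::euclidean_space \<Rightarrow> ereal) \<Rightarrow> bool" where
  "ell_smooth ell f \<longleftrightarrow>
     (\<forall>x\<in>effdom f. (\<lambda>z. real_of_ereal (f z)) differentiable (at x)) \<and>
     (\<forall>x\<in>effdom f. gradient f differentiable (at x)) \<and>
     continuous_on (closure (effdom f)) f \<and>
     mono_on {0..} ell \<and> (\<forall>s\<ge>0. 0 < ell s) \<and>
     local_lipschitz (UNIV :: real set) {0..} (\<lambda>_. ell) \<and>
     (\<forall>x\<in>effdom f. onorm (hessian f x) \<le> ell (norm (gradient f x)))"

definition eps_solution :: "('a \<Rightarrow> ereal) \<Rightarrow> real \<Rightarrow> 'a \<Rightarrow> bool" where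
  "eps_solution f \<epsilon> z \<longleftrightarrow> f z - (INF x. f x) \<le> ereal \<epsilon>"

definition gd_step :: "(real \<Rightarrow> real) \<Rightarrow> ('a::euclidean_space \<Rightarrow> ereal) \<Rightarrow> 'a \<Rightarrow> real" where
  "gd_step ell f x =
     integral {0..1} (\<lambda>v. 1 / ell (norm (gradient f x) + norm (gradient f x) * v))"

primrec gd_iter :: "(real \<Rightarrow> real) \<Rightarrow> ('a::euclidean_space \<Rightarrow> ereal) \<Rightarrow> 'a \<Rightarrow> nat \<Rightarrow> 'a" where
  "gd_iter ell f x0 0 = x0"
| "gd_iter ell f x0 (Suc j) =
     gd_iter ell f x0 j
       - gd_step ell f (gd_iter ell f x0 j) *\<^sub>R gradient f (gd_iter ell f x0 j)"

(* Computing the iterate with index j uses the gradients at the iterates 0, ..., j - 1, that is,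
   j oracle calls; they must be made at points of effdom f.
   The infimum over the empty set is \<infinity>. *)
definition k_GD :: "(real \<Rightarrow> real) \<Rightarrow> ('a::euclidean_space \<Rightarrow> ereal) \<Rightarrow> 'a \<Rightarrow> 'a \<Rightarrow> real \<Rightarrow> enat" where
  "k_GD ell f xs x0 \<delta> =
     (INF j\<in>{j. (\<forall>i<j. gd_iter ell f x0 i \<in> effdom f)
                 \<and> f (gd_iter ell f x0 j) - f xs \<le> ereal (\<delta> / 2)}. enat j)"

(* The state is (y, u, \<Gamma>). *)
primrec phase2 ::
  "(real \<Rightarrow> real) \<Rightarrow> ('a::euclidean_space \<Rightarrow> ereal) \<Rightarrow> real \<Rightarrow> real \<Rightarrow> 'a \<Rightarrow> nat \<Rightarrow> 'a \<times> 'a \<times> real"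
where
  "phase2 ell f \<delta> Rbar xbar 0 = (xbar, xbar, \<delta> / Rbar\<^sup>2)"
| "phase2 ell f \<delta> Rbar xbar (Suc k) =
     (let (y, u, \<Gamma>) = phase2 ell f \<delta> Rbar xbar k;
          \<gamma> = 1 / (2 * ell 0);
          \<alpha> = sqrt (\<gamma> * \<Gamma>);
          y' = (1 / (1 + \<alpha>)) *\<^sub>R y + (\<alpha> / (1 + \<alpha>)) *\<^sub>R u - (\<gamma> / (1 + \<alpha>)) *\<^sub>R gradient f y;
          u' = closest_point (closure (effdom f)) (u - (\<alpha> / \<Gamma>) *\<^sub>R gradient f y')
      in (y', u', \<Gamma> / (1 + \<alpha>)))"

(* Each phase-2 iteration costs one new gradient: y with index k depends exactly on the gradients
   at y with indices 0, ..., k - 1.  If phase 1 does not terminate, the first summand is \<infinity>,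
   hence so is the sum, and the value of xbar is irrelevant. *)
definition alg1_complexity ::
  "(real \<Rightarrow> real) \<Rightarrow> ('a::euclidean_space \<Rightarrow> ereal) \<Rightarrow> 'a \<Rightarrow> 'a \<Rightarrow> real \<Rightarrow> real \<Rightarrow> real \<Rightarrow> enat"
where
  "alg1_complexity ell f xs x0 \<delta> Rbar \<epsilon> =
     (let xbar = gd_iter ell f x0 (the_enat (k_GD ell f xs x0 \<delta>));
          y = (\<lambda>k. fst (phase2 ell f \<delta> Rbar xbar k))
      in k_GD ell f xs x0 \<delta> +
           (INF k\<in>{k. (\<forall>i<k. y i \<in> effdom f) \<and> eps_solution f \<epsilon> (y k)}. enat k))"

(* Logarithm with log 0 = -\<infinity>; the library has log b 0 = 0. *)
definition elog :: "real \<Rightarrow> real \<Rightarrow> ereal" where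
  "elog b x = (if x = 0 then -\<infinity> else ereal (log b x))"

definition k_bound ::
  "(real \<Rightarrow> real) \<Rightarrow> ('a::euclidean_space \<Rightarrow> ereal) \<Rightarrow> 'a \<Rightarrow> 'a \<Rightarrow> real \<Rightarrow> ereal" where
  "k_bound ell f xs x0 \<delta> =
     max (1 + ereal (1 / 2) * elog (3 / 2) (\<delta> / (8 * ell 0 * (norm (x0 - xs))\<^sup>2))) 0
       + ereal_of_enat (k_GD ell f xs x0 \<delta>)"

definition admissible_delta :: "(real \<Rightarrow> real) \<Rightarrow> real set" where
  "admissible_delta ell = {\<delta>. 0 \<le> \<delta> \<and> ell (8 * sqrt (\<delta> * ell 0)) \<le> 2 * ell 0}"

definition ereal_ceiling :: "ereal \<Rightarrow> ereal" where
  "ereal_ceiling z = (if \<bar>z\<bar> = \<infinity> then z else ereal (of_int \<lceil>real_of_ereal z\<rceil>))"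

end

theory Submission
  imports Defs
begin

text \<open>On \<open>f x - f xs \<le> \<delta>\<close> the monotonicity of \<open>\<psi>\<close> and the admissibility of \<open>\<delta>\<close> bound the
  gradient norm by \<open>2 * B\<close> with \<open>B = sqrt (\<delta> * ell 0)\<close>, while the Hessian stays bounded by
  \<open>2 * ell 0\<close> as long as the gradient norm is at most \<open>8 * B\<close>. Gradient descent does not increase
  the distance to \<open>xs\<close>, so phase 2 starts with \<open>f y - f xs + \<Gamma> / 2 * (norm (u - xs))\<^sup>2 \<le> \<delta>\<close>.
  This Lyapunov function keeps the next iterate so close to \<open>y\<close> that the gradient changes
  by at most \<open>6 * B\<close>. Hence the usual inequalities for a \<open>2 * ell 0\<close>-smooth function are available,
  the Lyapunov function is divided by \<open>1 + \<alpha>\<close>, and \<open>f y - f xs \<le> R\<^sup>2 * \<Gamma>\<close>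
  at every iteration. It remains to estimate the recursion for \<open>\<Gamma>\<close>.\<close>

section \<open>Real induction, the Lyapunov inequality and the scalar recursion\<close>

text \<open>The infimum of the counterexamples would be good by \<open>limit\<close>, and
  \<open>extend\<close> would then exclude counterexamples just above it. This serves to continue
  along a segment two properties of which each secures the other.\<close>

lemma interval_induction:
  fixes P :: "real \<Rightarrow> bool"
  assumes zero: "P 0"
    and limit: "\<And>t. 0 < t \<Longrightarrow> t \<le> T \<Longrightarrow> (\<And>s. 0 \<le> s \<Longrightarrow> s < t \<Longrightarrow> P s) \<Longrightarrow> P t"
    and extend: "\<And>t. 0 \<le> t \<Longrightarrow> t < T \<Longrightarrow> (\<And>s. 0 \<le> s \<Longrightarrow> s \<le> t \<Longrightarrow> P s) \<Longrightarrow>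
        \<exists>e>0. \<forall>s. t < s \<and> s < t + e \<longrightarrow> P s"
    and "0 \<le> t" "t \<le> T"
  shows "P t"
proof (rule ccontr)
  assume "\<not> P t"
  define bad where "bad = {s. 0 \<le> s \<and> s \<le> T \<and> \<not> P s}"
  define b where "b = Inf bad"
  have ne: "bad \<noteq> {}" and bdd: "bdd_below bad"
    using \<open>\<not> P t\<close> assms(4,5) by (auto simp: bad_def intro!: bdd_belowI[of _ 0])
  have b0: "0 \<le> b" and bT: "b \<le> T"
    using ne bdd \<open>\<not> P t\<close> assms(4,5)
    by (auto simp: b_def bad_def intro!: cInf_greatest intro: cInf_lower2)
  have good: "P s" if "0 \<le> s" "s < b" for s
    using cInf_lower[OF _ bdd, of s] that bT by (fastforce simp: b_def bad_def)
  have "P b"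
    using zero limit[of b] b0 bT good by (cases "b = 0") auto
  then have good': "P s" if "0 \<le> s" "s \<le> b" for s
    using good that by (cases "s = b") auto
  have "b < T"
  proof (rule ccontr)
    assume "\<not> b < T"
    then show False using good' assms(4,5) \<open>\<not> P t\<close> by auto
  qed
  then obtain e where "e > 0" and e: "\<And>s. b < s \<Longrightarrow> s < b + e \<Longrightarrow> P s"
    using extend[OF b0 _ good'] by blast
  have "b + e \<le> b"
    unfolding b_def
  proof (rule cInf_greatest[OF ne])
    fix s assume s: "s \<in> bad"
    then have "b \<le> s" using cInf_lower[OF s bdd] by (simp add: b_def)
    moreover have "0 \<le> s" "\<not> P s" using s by (auto simp: bad_def)
    ultimately show "Inf bad + e \<le> s"
      using e[of s] good'[of s] by (cases "s = b") (auto simp: b_def[symmetric] not_less[symmetric])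
  qed
  with \<open>e > 0\<close> show False by simp
qed

text \<open>Multiplying the update of \<open>y\<close> by \<open>1 + a\<close> shows that
  \<open>interp\<close> plus \<open>a\<close> times \<open>interp_min\<close> contains only the
  inner products \<open>g' \<bullet> (u - xs)\<close> and \<open>g' \<bullet> g\<close>. The first
  cancels against the expanded square of \<open>proj\<close>, the second against that of
  \<open>norm (g - g')\<close>, and \<open>a\<^sup>2 / \<Gamma> = \<gamma>\<close> balances the
  remaining squares of \<open>g'\<close>.\<close>

lemma lyapunov_step:
  fixes y y' u u' g g' xs :: "'a::real_inner"
  assumes pos: "0 < a" "0 < \<Gamma>" and a: "a\<^sup>2 = \<gamma> * \<Gamma>"
    and y': "y' = (1 / (1 + a)) *\<^sub>R y + (a / (1 + a)) *\<^sub>R u - (\<gamma> / (1 + a)) *\<^sub>R g"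
    and interp: "\<phi>' + g' \<bullet> (y - y') + \<gamma> / 2 * (norm (g - g'))\<^sup>2 \<le> \<phi>"
    and interp_min: "\<phi>' + g' \<bullet> (xs - y') + \<gamma> / 2 * (norm g')\<^sup>2 \<le> \<phi>s"
    and proj: "norm (u' - xs) \<le> norm (u - (a / \<Gamma>) *\<^sub>R g' - xs)"
  shows "(1 + a) * (\<phi>' - \<phi>s) + \<Gamma> / 2 * (norm (u' - xs))\<^sup>2 \<le> \<phi> - \<phi>s + \<Gamma> / 2 * (norm (u - xs))\<^sup>2"
proof -
  have "\<gamma> = a\<^sup>2 / \<Gamma>" using a pos by (simp add: field_simps)
  then have \<gamma>: "0 < \<gamma>" using pos by simp
  have "(1 + a) *\<^sub>R y' = y + a *\<^sub>R u - \<gamma> *\<^sub>R g"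
    unfolding y' scaleR_diff_right scaleR_add_right scaleR_scaleR using pos by simp
  then have "g' \<bullet> (y - y') + a * (g' \<bullet> (xs - y')) = g' \<bullet> (y + a *\<^sub>R xs - (y + a *\<^sub>R u - \<gamma> *\<^sub>R g))"
    by (metis (no_types, lifting) add_diff_add inner_add_right inner_scaleR_right scaleR_add_left
        scaleR_diff_right scaleR_one)
  also have "\<dots> = - a * (g' \<bullet> (u - xs)) + \<gamma> * (g' \<bullet> g)"
    by (simp add: algebra_simps)
  finally have inner: "g' \<bullet> (y - y') + a * (g' \<bullet> (xs - y')) = - a * (g' \<bullet> (u - xs)) + \<gamma> * (g' \<bullet> g)" .
  have "a * (\<phi>' + g' \<bullet> (xs - y') + \<gamma> / 2 * (norm g')\<^sup>2) \<le> a * \<phi>s"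
    using interp_min pos by (intro mult_left_mono) auto
  with interp inner
  have 1: "(1 + a) * \<phi>' - a * (g' \<bullet> (u - xs)) + \<gamma> * (g' \<bullet> g)
      + \<gamma> / 2 * (norm (g - g'))\<^sup>2 + a * (\<gamma> / 2 * (norm g')\<^sup>2) \<le> \<phi> + a * \<phi>s"
    by (simp add: algebra_simps)
  have 2: "\<gamma> / 2 * (norm (g - g'))\<^sup>2 = \<gamma> / 2 * (norm g)\<^sup>2 - \<gamma> * (g' \<bullet> g) + \<gamma> / 2 * (norm g')\<^sup>2"
    by (simp add: power2_norm_eq_inner inner_diff_left inner_diff_right inner_commute field_simps)
  have "(norm (u' - xs))\<^sup>2 \<le> (norm (u - (a / \<Gamma>) *\<^sub>R g' - xs))\<^sup>2"
    using proj by (rule power_mono) simp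
  also have "\<dots> = (norm (u - xs))\<^sup>2 - 2 * (a / \<Gamma>) * (g' \<bullet> (u - xs)) + (a / \<Gamma>)\<^sup>2 * (norm g')\<^sup>2"
    unfolding power2_norm_eq_inner Groups.diff_right_commute[of u _ xs]
    by (simp add: inner_diff_left[of "u - xs"] inner_diff_right[of _ "u - xs"] inner_commute[of "u - xs" g']
        power2_eq_square right_diff_distrib diff_divide_distrib)
  finally have "\<Gamma> / 2 * (norm (u' - xs))\<^sup>2 \<le>
      \<Gamma> / 2 * ((norm (u - xs))\<^sup>2 - 2 * (a / \<Gamma>) * (g' \<bullet> (u - xs)) + (a / \<Gamma>)\<^sup>2 * (norm g')\<^sup>2)"
    using pos by (intro mult_left_mono) auto
  also have "\<dots> = \<Gamma> / 2 * (norm (u - xs))\<^sup>2 - a * (g' \<bullet> (u - xs)) + a\<^sup>2 / \<Gamma> / 2 * (norm g')\<^sup>2"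
    using pos by (simp add: field_simps power2_eq_square)
  also have "a\<^sup>2 / \<Gamma> = \<gamma>" using \<open>\<gamma> = _\<close> by simp
  finally have 3: "\<Gamma> / 2 * (norm (u' - xs))\<^sup>2 \<le>
      \<Gamma> / 2 * (norm (u - xs))\<^sup>2 - a * (g' \<bullet> (u - xs)) + \<gamma> / 2 * (norm g')\<^sup>2" .
  have 4: "0 \<le> \<gamma> / 2 * (norm g)\<^sup>2" "0 \<le> a * (\<gamma> / 2 * (norm g')\<^sup>2)"
    using \<gamma> pos by auto
  show ?thesis using 1 2 3 4 by (simp add: algebra_simps)
qed

text \<open>While \<open>s k > 4\<close>, each step divides by at least \<open>3 \<ge> (3 / 2)\<^sup>2\<close>; afterwards
  \<open>1 / sqrt (s k)\<close> grows by at least \<open>1 / 3\<close> per step.\<close>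

lemma decay_rate:
  fixes s :: "nat \<Rightarrow> real"
  assumes s0: "0 < s 0" and Suc: "\<And>k. s (Suc k) = s k / (1 + sqrt (s k))" and T: "0 < T"
    and k: "5 / sqrt (2 * T) + max (1 + log (3 / 2) (s 0 / 4) / 2) 0 \<le> real k"
  shows "s k \<le> T"
proof -
  have pos: "0 < s k" for k
    by (induction k) (use s0 in \<open>auto simp: Suc intro!: divide_pos_pos add_pos_nonneg\<close>)
  have early: "s k \<le> max 4 (s 0 * (4 / 9) ^ k)" for k
  proof (induction k)
    case (Suc k)
    show ?case
    proof (cases "s k \<le> 4")
      case True
      have "s (Suc k) \<le> s k"
        using frac_le[of "s k" "s k" 1 "1 + sqrt (s k)"] pos[of k] unfolding assms(2) by simp
      with True show ?thesis by simp
    next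
      case False
      then have "2 < sqrt (s k)" by (simp add: real_less_rsqrt)
      then have "s (Suc k) \<le> s k * (4 / 9)"
        using pos[of k] unfolding assms(2) by (simp add: divide_le_eq)
      with Suc False show ?thesis by simp
    qed
  qed simp
  \<comment> \<open>Since \<open>(4 / 9) ^ n = (2 / 3) ^ (2 * n)\<close>, half the logarithm of
    \<open>s 0 / 4\<close> counts the steps until \<open>s\<close> is at most 4.\<close>
  define l where "l = log (3 / 2) (s 0 / 4) / 2"
  define n where "n = nat \<lceil>l\<rceil>"
  have n_le: "real n \<le> max (1 + l) 0"
    unfolding n_def by linarith
  have "s 0 * (4 / 9) ^ n \<le> 4"
  proof -
    have "log (3 / 2) (s 0 / 4) \<le> real (2 * n)"
      unfolding n_def l_def by linarith
    then have "s 0 / 4 \<le> (3 / 2) ^ (2 * n)"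
      using s0 powr_realpow[of "3 / 2" "2 * n"] by (subst (asm) log_le_iff) auto
    also have "\<dots> = (9 / 4) ^ n"
      by (simp add: power_mult power2_eq_square)
    finally show ?thesis
      by (simp add: power_divide field_simps)
  qed
  with early[of n] have sn: "s n \<le> 4" by simp
  have late: "1 / 2 + real j / 3 \<le> 1 / sqrt (s (n + j))" for j
  proof (induction j)
    case 0
    have "sqrt (s n) \<le> 2" using sn by (simp add: real_le_lsqrt)
    then show ?case using pos[of n] by (simp add: field_simps)
  next
    case (Suc j)
    define r where "r = 1 / sqrt (s (n + j))"
    have r: "1 / 2 \<le> r" using Suc by (simp add: r_def)
    \<comment> \<open>The recursion reads \<open>1 / s (n + Suc j) = r\<^sup>2 + r\<close>, which is
      at least the square of \<open>r + 1 / 3\<close> once \<open>r \<ge> 1 / 3\<close>.\<close>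
    have "r + 1 / 3 \<le> sqrt (r\<^sup>2 + r)"
      using r by (intro real_le_rsqrt) (simp add: power2_eq_square algebra_simps)
    also have "r\<^sup>2 + r = 1 / s (n + Suc j)"
      using pos[of "n + j"] by (simp add: r_def assms(2) field_simps power2_eq_square)
    also have "sqrt (1 / s (n + Suc j)) = 1 / sqrt (s (n + Suc j))"
      by (simp add: real_sqrt_divide)
    finally show ?case using Suc by (simp add: r_def add_divide_distrib)
  qed
  have kn: "5 / sqrt (2 * T) + real n \<le> real k"
    using k n_le by (simp add: l_def)
  have sT: "0 < sqrt T" "0 \<le> 5 / sqrt (2 * T)" using T by simp_all
  then have "n \<le> k" using kn by linarith
  \<comment> \<open>After step \<open>n\<close>, \<open>3 / sqrt T\<close> steps suffice; the
    constant 5 covers them because \<open>5 / sqrt 2 \<ge> 3\<close>.\<close>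
  have "sqrt 2 \<le> 5 / 3"
    by (rule real_le_lsqrt) (auto simp: power2_eq_square)
  then have "3 / sqrt T \<le> 5 / sqrt (2 * T)"
    using sT by (simp add: real_sqrt_mult field_simps)
  then have "3 / sqrt T \<le> real (k - n)"
    using kn \<open>n \<le> k\<close> by (simp add: of_nat_diff)
  then have "1 / sqrt T \<le> 1 / sqrt (s k)"
    using late[of "k - n"] \<open>n \<le> k\<close> by (simp add: field_simps)
  then have "sqrt (s k) \<le> sqrt T"
    using pos[of k] sT by (simp add: field_simps)
  then show ?thesis by simp
qed

text \<open>\<open>enat\<close> is well-ordered, so a finite infimum is attained. Thus a finite
  complexity is the index of an actual iterate.\<close>

lemma INF_enat_mem:
  assumes "(INF j\<in>A. enat j) = enat n"
  shows "n \<in> A"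
proof -
  have "A \<noteq> {}" using assms by (auto simp: top_enat_def)
  then have "(INF j\<in>A. enat j) \<in> enat ` A"
    unfolding Inf_enat_def by (auto intro: LeastI)
  with assms show ?thesis by auto
qed

section \<open>Convex \<open>ell\<close>-smooth functions: local Lipschitz and descent
  estimates\<close>

locale convex_ell_smooth =
  fixes f :: "'a::euclidean_space \<Rightarrow> ereal" and ell :: "real \<Rightarrow> real"
  assumes not_minf: "\<And>x. f x \<noteq> -\<infinity>"
    and open_dom: "open (effdom f)"
    and convex_dom: "convex (effdom f)"
    and convex_f: "convex_ext f"
    and smooth: "ell_smooth ell f"
begin

abbreviation X :: "'a set" where "X \<equiv> effdom f"
abbreviation F :: "'a \<Rightarrow> real" where "F x \<equiv> real_of_ereal (f x)"
abbreviation G :: "'a \<Rightarrow> 'a" where "G \<equiv> gradient f"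

lemma f_eq: "x \<in> X \<Longrightarrow> f x = ereal (F x)"
  using not_minf[of x] by (cases "f x") (auto simp: effdom_def)

lemma ell_mono: "0 \<le> s \<Longrightarrow> s \<le> t \<Longrightarrow> ell s \<le> ell t"
  using smooth by (auto simp: ell_smooth_def mono_on_def)

lemma ell_pos: "0 \<le> s \<Longrightarrow> 0 < ell s"
  using smooth by (auto simp: ell_smooth_def)

text \<open>\<open>gradient\<close> is a definite description, so a representing vector must exist
  and be unique: \<open>adjoint D 1\<close> represents the derivative \<open>D\<close>, and a vector
  is determined by its inner products.\<close>

lemma F_has_derivative:
  assumes "x \<in> X"
  shows "(F has_derivative (\<lambda>h. h \<bullet> G x)) (at x)"
proof -
  obtain D where D: "(F has_derivative D) (at x)"
    using smooth assms unfolding ell_smooth_def differentiable_def by blast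
  then have "linear D"
    by (simp add: bounded_linear.linear has_derivative_bounded_linear)
  then have "D = (\<lambda>h. h \<bullet> adjoint D 1)"
    using adjoint_works[of D _ 1] by auto
  with D have "GDERIV F x :> adjoint D 1"
    unfolding gderiv_def by simp
  moreover have "g = g'" if "GDERIV F x :> g" "GDERIV F x :> g'" for g g'
  proof -
    have "(\<lambda>h. h \<bullet> g) = (\<lambda>h. h \<bullet> g')"
      using that unfolding gderiv_def by (rule has_derivative_unique)
    then show ?thesis
      by (metis vector_eq_ldot)
  qed
  ultimately have "GDERIV F x :> G x"
    unfolding gradient_def by (blast intro: theI)
  then show ?thesis by (simp add: gderiv_def)
qed

lemma G_has_derivative: "x \<in> X \<Longrightarrow> (G has_derivative hessian f x) (at x)"
  using smooth frechet_derivative_works unfolding ell_smooth_def hessian_def by blast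

lemma isCont_G: "x \<in> X \<Longrightarrow> isCont G x"
  by (rule has_derivative_continuous[OF G_has_derivative])

lemma onorm_hessian_le: "x \<in> X \<Longrightarrow> onorm (hessian f x) \<le> ell (norm (G x))"
  using smooth by (auto simp: ell_smooth_def)

lemma F_line_has_derivative:
  assumes "p + t *\<^sub>R w \<in> X"
  shows "((\<lambda>t. F (p + t *\<^sub>R w)) has_real_derivative w \<bullet> G (p + t *\<^sub>R w)) (at t)"
proof -
  have "((\<lambda>t. p + t *\<^sub>R w) has_derivative (\<lambda>h. h *\<^sub>R w)) (at t)"
    by (auto intro!: derivative_eq_intros)
  from has_derivative_compose[OF this F_has_derivative[OF assms]]
  show ?thesis
    by (simp add: has_field_derivative_def mult.commute[of "w \<bullet> G (p + t *\<^sub>R w)"] mult_commute_abs)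
qed

lemma first_order_convexity:
  assumes "x \<in> X" "z \<in> X"
  shows "F x + G x \<bullet> (z - x) \<le> F z"
proof -
  have "((\<lambda>t. (F (x + t *\<^sub>R (z - x)) - F x) / t) \<longlongrightarrow> (z - x) \<bullet> G x) (at_right 0)"
    using F_line_has_derivative[of x 0 "z - x"] assms
    by (auto simp: DERIV_def intro: tendsto_mono at_le)
  moreover have "\<forall>\<^sub>F t in at_right 0. (F (x + t *\<^sub>R (z - x)) - F x) / t \<le> F z - F x"
    unfolding eventually_at_right_field
  proof (intro exI[of _ 1] conjI allI impI)
    fix t :: real assume t: "0 < t" "t < 1"
    have eq: "x + t *\<^sub>R (z - x) = (1 - t) *\<^sub>R x + t *\<^sub>R z"
      by (simp add: algebra_simps)
    have "(1 - t) *\<^sub>R x + t *\<^sub>R z \<in> X"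
      using assms t convex_dom by (intro convexD) auto
    moreover have "f ((1 - t) *\<^sub>R x + t *\<^sub>R z) \<le> ereal (1 - t) * f x + ereal t * f z"
      using convex_f t by (auto simp: convex_ext_def)
    ultimately have "F ((1 - t) *\<^sub>R x + t *\<^sub>R z) \<le> (1 - t) * F x + t * F z"
      using f_eq assms by (metis ereal_less_eq(3) plus_ereal.simps(1) times_ereal.simps(1))
    then show "(F (x + t *\<^sub>R (z - x)) - F x) / t \<le> F z - F x"
      using t unfolding eq by (simp add: field_simps)
  qed simp
  ultimately have "(z - x) \<bullet> G x \<le> F z - F x"
    by (intro tendsto_upperbound) auto
  then show ?thesis by (simp add: inner_commute)
qed

text \<open>A limit of domain points with bounded values again has a finite value. This keeps limits
  along a segment inside the open domain.\<close>

lemma sublevel_closed: "closed {x \<in> closure X. f x \<le> ereal c}"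
proof -
  have "closed (closure X \<inter> f -` {..ereal c})"
    using smooth by (intro continuous_closed_preimage) (auto simp: ell_smooth_def)
  then show ?thesis by (simp add: vimage_def Int_def)
qed

text \<open>The two claims are continued together along the segment: the Lipschitz estimate keeps
  the gradient norm below \<open>M\<close>, and there the Hessian is bounded by \<open>L\<close>,
  which reproduces the estimate.\<close>

lemma segment_step:
  assumes p: "p \<in> X" and L: "0 < L" "ell M \<le> L" and M: "norm (G p) + L * norm w \<le> M"
    and t: "0 \<le> t" "t \<le> 1"
  shows "p + t *\<^sub>R w \<in> X \<and> norm (G (p + t *\<^sub>R w) - G p) \<le> L * t * norm w"
proof (cases "w = 0")
  case True
  with p show ?thesis by simp
next
  case False
  define P where "P t \<longleftrightarrow> p + t *\<^sub>R w \<in> X \<and> norm (G (p + t *\<^sub>R w) - G p) \<le> L * t * norm w" for t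
  \<comment> \<open>Strictness for \<open>s < 1\<close> leaves room to extend by continuity; it
    relies on \<open>w \<noteq> 0\<close>.\<close>
  have G_less: "norm (G (p + s *\<^sub>R w)) < M" if "P s" "s < 1" for s
  proof -
    have "norm (G (p + s *\<^sub>R w)) \<le> norm (G p) + L * s * norm w"
      using that(1) norm_triangle_sub[of "G (p + s *\<^sub>R w)" "G p"] by (simp add: P_def)
    also have "L * s * norm w < L * norm w"
      using that(2) L False by simp
    finally show ?thesis using M by simp
  qed
  have cont_line: "((\<lambda>s. p + s *\<^sub>R w) \<longlongrightarrow> p + t *\<^sub>R w) (at t within S)" for t S
    by (intro tendsto_intros)
  have "P t"
  proof (rule interval_induction[where P = P])
    show "P 0" using p by (simp add: P_def)
  next
    fix t :: real
    assume t: "0 < t" "t \<le> 1" and IH: "\<And>s. 0 \<le> s \<Longrightarrow> s < t \<Longrightarrow> P s"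
    \<comment> \<open>The tangent at the moving point, evaluated at \<open>p\<close>, bounds
      \<open>f\<close> uniformly before \<open>t\<close>, so the point reached at \<open>t\<close>
      cannot have value \<infinity>.\<close>
    have le: "f (p + s *\<^sub>R w) \<le> ereal (F p + M * norm w)" if "0 \<le> s" "s < t" for s
    proof -
      have s: "p + s *\<^sub>R w \<in> X" "P s" using IH[OF that] by (auto simp: P_def)
      have "F (p + s *\<^sub>R w) \<le> F p + s * (G (p + s *\<^sub>R w) \<bullet> w)"
        using first_order_convexity[OF s(1) p] by simp
      also have "G (p + s *\<^sub>R w) \<bullet> w \<le> norm (G (p + s *\<^sub>R w)) * norm w"
        by (rule norm_cauchy_schwarz)
      also have "s * (norm (G (p + s *\<^sub>R w)) * norm w) \<le> 1 * (M * norm w)"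
        using G_less[OF s(2)] order.strict_trans1[OF norm_ge_zero G_less[OF s(2)]] that t
        by (intro mult_mono) auto
      finally have "F (p + s *\<^sub>R w) \<le> F p + M * norm w"
        using that by (simp add: mult_left_mono)
      then show ?thesis using f_eq[OF s(1)] by (metis ereal_less_eq(3))
    qed
    have ev: "\<forall>\<^sub>F s in at_left t. 0 \<le> s \<and> s < t"
      using t eventually_at_left_real[of 0 t] by (auto elim: eventually_mono)
    have "p + t *\<^sub>R w \<in> {x \<in> closure X. f x \<le> ereal (F p + M * norm w)}"
    proof (rule Lim_in_closed_set[OF sublevel_closed _ _ cont_line])
      show "\<forall>\<^sub>F s in at_left t. p + s *\<^sub>R w \<in> {x \<in> closure X. f x \<le> ereal (F p + M * norm w)}"
        using ev
      proof eventually_elim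
        case (elim s)
        then show ?case
          using le[of s] IH[of s] closure_subset[of X] by (auto simp: P_def)
      qed
    qed simp
    then have "f (p + t *\<^sub>R w) \<le> ereal (F p + M * norm w)" by simp
    then have X: "p + t *\<^sub>R w \<in> X"
      by (auto simp: effdom_def elim: order.strict_trans1)
    have "norm (G (p + t *\<^sub>R w) - G p) \<le> L * t * norm w"
    proof (rule tendsto_le[of "at_left t"])
      show "((\<lambda>s. L * s * norm w) \<longlongrightarrow> L * t * norm w) (at_left t)"
        by (intro tendsto_intros)
      show "((\<lambda>s. norm (G (p + s *\<^sub>R w) - G p)) \<longlongrightarrow> norm (G (p + t *\<^sub>R w) - G p)) (at_left t)"
        using isCont_tendsto_compose[OF isCont_G[OF X] cont_line] by (intro tendsto_intros)
      show "\<forall>\<^sub>F s in at_left t. norm (G (p + s *\<^sub>R w) - G p) \<le> L * s * norm w"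
        using ev by eventually_elim (use IH in \<open>auto simp: P_def\<close>)
    qed simp
    with X show "P t" by (simp add: P_def)
  next
    fix t :: real
    assume t: "0 \<le> t" "t < 1" and IH: "\<And>s. 0 \<le> s \<Longrightarrow> s \<le> t \<Longrightarrow> P s"
    have X: "p + t *\<^sub>R w \<in> X" using IH[of t] t by (simp add: P_def)
    have "\<forall>\<^sub>F s in at t. p + s *\<^sub>R w \<in> X"
      using topological_tendstoD[OF cont_line open_dom X] .
    moreover have "\<forall>\<^sub>F s in at t. norm (G (p + s *\<^sub>R w)) < M"
      using G_less[OF IH[of t]] t
      by (intro order_tendstoD(2)[OF tendsto_norm[OF
            isCont_tendsto_compose[OF isCont_G[OF X] cont_line]]]) auto
    ultimately have "\<forall>\<^sub>F s in at t. p + s *\<^sub>R w \<in> X \<and> norm (G (p + s *\<^sub>R w)) < M"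
      by eventually_elim auto
    then obtain e where e: "e > 0"
      and near: "\<And>s. s \<noteq> t \<Longrightarrow> dist s t < e \<Longrightarrow> p + s *\<^sub>R w \<in> X \<and> norm (G (p + s *\<^sub>R w)) < M"
      by (auto simp: eventually_at)
    show "\<exists>e>0. \<forall>s. t < s \<and> s < t + e \<longrightarrow> P s"
    proof (intro exI[of _ e] conjI allI impI)
      fix s assume s: "t < s \<and> s < t + e"
      have seg: "p + r *\<^sub>R w \<in> X \<and> norm (G (p + r *\<^sub>R w)) < M" if "0 \<le> r" "r \<le> s" for r
      proof (cases "r \<le> t")
        case True
        then show ?thesis using IH[of r] that G_less[of r] t by (auto simp: P_def)
      next
        case False
        then show ?thesis using near[of r] that s by (auto simp: dist_real_def)
      qed
      define S where "S = closed_segment p (p + s *\<^sub>R w)"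
      have S: "x \<in> X \<and> norm (G x) < M" if x: "x \<in> S" for x
      proof -
        obtain r where r: "0 \<le> r" "r \<le> 1" "x = (1 - r) *\<^sub>R p + r *\<^sub>R (p + s *\<^sub>R w)"
          using x by (auto simp: S_def in_segment)
        then have "x = p + (r * s) *\<^sub>R w" by (simp add: algebra_simps)
        then show ?thesis
          using seg[of "r * s"] r s t by (simp add: mult_left_le_one_le)
      qed
      \<comment> \<open>The mean value inequality is applied on the whole segment from
        \<open>p\<close>, so the constant stays \<open>L\<close> after each extension.\<close>
      have "norm (G (p + s *\<^sub>R w) - G p) \<le> L * norm ((p + s *\<^sub>R w) - p)"
      proof (rule differentiable_bound[of S G "hessian f"])
        fix x assume "x \<in> S"
        then have x: "x \<in> X" "norm (G x) < M" using S by auto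
        then show "(G has_derivative hessian f x) (at x within S)"
          by (blast intro: has_derivative_at_withinI G_has_derivative)
        show "onorm (hessian f x) \<le> L"
          using onorm_hessian_le[OF x(1)] ell_mono[of "norm (G x)" M] x(2) L by simp
      qed (auto simp: S_def)
      then show "P s" using seg[of s] s t by (auto simp: P_def)
    qed (use e in simp)
  qed (use t in auto)
  then show ?thesis by (simp add: P_def)
qed

lemma local_descent:
  assumes p: "p \<in> X" and L: "0 < L" "ell M \<le> L" and M: "norm (G p) + L * norm w \<le> M"
  shows "p + w \<in> X" "norm (G (p + w) - G p) \<le> L * norm w"
    "F (p + w) \<le> F p + G p \<bullet> w + L / 2 * (norm w)\<^sup>2"
proof -
  note seg = segment_step[OF p L M]
  show "p + w \<in> X" "norm (G (p + w) - G p) \<le> L * norm w"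
    using seg[of 1] by simp_all
  \<comment> \<open>Subtracting the quadratic model leaves a function of \<open>t\<close> whose
    derivative is nonpositive by the Lipschitz estimate along the segment.\<close>
  define \<phi> where "\<phi> t = F (p + t *\<^sub>R w) - t * (G p \<bullet> w) - L / 2 * t\<^sup>2 * (norm w)\<^sup>2" for t
  have "\<phi> 1 \<le> \<phi> 0"
  proof (rule DERIV_nonpos_imp_nonincreasing[of 0 1 \<phi>])
    fix t :: real assume t: "0 \<le> t" "t \<le> 1"
    have "(\<phi> has_real_derivative w \<bullet> G (p + t *\<^sub>R w) - G p \<bullet> w - L * t * (norm w)\<^sup>2) (at t)"
      unfolding \<phi>_def using F_line_has_derivative[of p t w] seg[OF t]
      by (auto intro!: derivative_eq_intros)
    moreover have "w \<bullet> G (p + t *\<^sub>R w) - G p \<bullet> w - L * t * (norm w)\<^sup>2 \<le> 0"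
    proof -
      have "w \<bullet> G (p + t *\<^sub>R w) - G p \<bullet> w = (G (p + t *\<^sub>R w) - G p) \<bullet> w"
        by (simp add: inner_diff_left inner_commute[of w])
      also have "\<dots> \<le> norm (G (p + t *\<^sub>R w) - G p) * norm w"
        by (rule norm_cauchy_schwarz)
      also have "\<dots> \<le> L * t * norm w * norm w"
        using seg[OF t] by (intro mult_right_mono) auto
      finally show ?thesis by (simp add: power2_eq_square mult.assoc)
    qed
    ultimately show "\<exists>y. (\<phi> has_real_derivative y) (at t) \<and> y \<le> 0" by blast
  qed simp
  then show "F (p + w) \<le> F p + G p \<bullet> w + L / 2 * (norm w)\<^sup>2"
    by (simp add: \<phi>_def)
qed

text \<open>Only the gradient at the base point \<open>y\<close> and the gradient difference enter the
  smoothness constant, so that a point whose own gradient is still uncontrolled can be compared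
  with a good one.\<close>

lemma cocoercivity:
  assumes "x \<in> X" "y \<in> X" and L: "ell (norm (G y) + norm (G y - G x)) \<le> L"
  shows "F x + G x \<bullet> (y - x) + (norm (G y - G x))\<^sup>2 / (2 * L) \<le> F y"
proof -
  define d where "d = G y - G x"
  \<comment> \<open>This step minimizes the quadratic upper bound at \<open>y\<close> of
    \<open>F\<close> minus its tangent at \<open>x\<close>, a function that is nonnegative on
    \<open>X\<close>. Its length satisfies \<open>L * norm w = norm d\<close>, which matches the
    argument of \<open>ell\<close> in the hypothesis.\<close>
  define w where "w = - (1 / L) *\<^sub>R d"
  have Lpos: "0 < L" using ell_pos[of "norm (G y) + norm (G y - G x)"] L by simp
  have nw: "norm w = norm d / L" using Lpos by (simp add: w_def)
  have "norm (G y) + L * norm w \<le> norm (G y) + norm d"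
    using Lpos by (simp add: nw)
  note loc = local_descent[OF \<open>y \<in> X\<close> Lpos L[folded d_def] this]
  have "F x + G x \<bullet> (y + w - x) \<le> F (y + w)"
    by (rule first_order_convexity[OF \<open>x \<in> X\<close> loc(1)])
  also have "\<dots> \<le> F y + G y \<bullet> w + L / 2 * (norm w)\<^sup>2"
    by (rule loc(3))
  finally have "F x + G x \<bullet> (y - x) \<le> F y + d \<bullet> w + L / 2 * (norm w)\<^sup>2"
    by (simp add: d_def inner_diff_left inner_diff_right inner_add_right)
  also have "d \<bullet> w = - ((norm d)\<^sup>2 / L)"
    by (simp add: w_def power2_norm_eq_inner)
  also have "L / 2 * (norm w)\<^sup>2 = (norm d)\<^sup>2 / (2 * L)"
    using Lpos by (simp add: nw power_divide power2_eq_square)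
  finally show ?thesis
    using Lpos by (simp add: d_def field_simps)
qed

end

section \<open>Estimates relative to a minimizer and gradient descent\<close>

locale minimized_ell_smooth = convex_ell_smooth +
  fixes xs :: 'a
  assumes minimizer: "\<And>x. f xs \<le> f x"
    and dom_nonempty: "effdom f \<noteq> {}"
begin

lemma xs_in_dom: "xs \<in> X"
  using dom_nonempty minimizer by (auto simp: effdom_def intro: order.strict_trans1)

lemma INF_f: "(INF x. f x) = f xs"
  using minimizer by (intro antisym INF_lower INF_greatest) auto

lemma F_xs_le: "x \<in> X \<Longrightarrow> F xs \<le> F x"
  using minimizer[of x] xs_in_dom f_eq by (metis ereal_less_eq(3))

lemma G_xs: "G xs = 0"
proof -
  have "(\<lambda>h. h \<bullet> G xs) = (\<lambda>h. 0)"
    using F_xs_le by (intro differential_zero_maxmin[OF xs_in_dom open_dom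
          F_has_derivative[OF xs_in_dom]]) auto
  then show ?thesis by (metis inner_eq_zero_iff)
qed

text \<open>The base point is \<open>xs\<close>, where the gradient vanishes, so \<open>ell\<close>
  is evaluated only at the gradient difference \<open>norm (G x)\<close>.\<close>

lemma cocoercivity_at_min:
  assumes "x \<in> X" "ell (norm (G x)) \<le> L"
  shows "F x - F xs + (norm (G x))\<^sup>2 / (2 * L) \<le> G x \<bullet> (x - xs)"
  using cocoercivity[OF assms(1) xs_in_dom, of L] assms(2)
  by (simp add: G_xs inner_diff_right)

text \<open>With base point \<open>x\<close>, cocoercivity uses \<open>ell (2 * norm (G x))\<close>;
  this is enlarged so that the left side becomes \<psi> at \<open>norm (G x)\<close>.\<close>

lemma gradient_gap:
  assumes "x \<in> X"
  shows "(norm (G x))\<^sup>2 / (2 * ell (4 * norm (G x))) \<le> F x - F xs"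
proof -
  have "ell (norm (G x) + norm (G x)) \<le> ell (4 * norm (G x))"
    by (rule ell_mono) auto
  from cocoercivity[OF xs_in_dom assms, of "ell (4 * norm (G x))"] this
  show ?thesis by (simp add: G_xs)
qed

text \<open>Expanding the square, the gain \<open>2 * \<eta> * (G x \<bullet> (x - xs))\<close>
  outweighs the squared step length by cocoercivity at the minimizer. Both the gradient descent step
  and the gradient part of a phase 2 step are of this form.\<close>

lemma step_closer:
  assumes x: "x \<in> X" and \<eta>: "0 \<le> \<eta>" "\<eta> \<le> 1 / ell (norm (G x))"
  shows "norm (x - \<eta> *\<^sub>R G x - xs) \<le> norm (x - xs)"
proof -
  have L: "0 < ell (norm (G x))" by (rule ell_pos) simp
  have "\<eta>\<^sup>2 * (norm (G x))\<^sup>2 \<le> \<eta> * (1 / ell (norm (G x))) * (norm (G x))\<^sup>2"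
    unfolding power2_eq_square[of \<eta>] using \<eta> by (intro mult_right_mono mult_left_mono) auto
  also have "\<dots> = 2 * \<eta> * ((norm (G x))\<^sup>2 / (2 * ell (norm (G x))))"
    by simp
  also have "\<dots> \<le> 2 * \<eta> * (G x \<bullet> (x - xs))"
    using cocoercivity_at_min[OF x order_refl] F_xs_le[OF x] \<eta> by (intro mult_left_mono) auto
  finally have "(norm (x - \<eta> *\<^sub>R G x - xs))\<^sup>2 \<le> (norm (x - xs))\<^sup>2"
    unfolding power2_norm_eq_inner
    by (simp add: inner_diff_left inner_diff_right inner_commute power2_eq_square algebra_simps)
  then show ?thesis by (rule power2_le_imp_le) simp
qed

text \<open>As \<open>ell\<close> is non-decreasing, the integrand is largest at
  \<open>v = 0\<close>.\<close>

lemma gd_step_bounds: "0 \<le> gd_step ell f x" "gd_step ell f x \<le> 1 / ell (norm (G x))"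
proof -
  define h where "h v = 1 / ell (norm (G x) + norm (G x) * v)" for v
  have L: "0 < ell (norm (G x))" by (rule ell_pos) simp
  have h: "0 \<le> h v" "h v \<le> 1 / ell (norm (G x))" if "0 \<le> v" for v
    using ell_pos[of "norm (G x) + norm (G x) * v"] that L
      ell_mono[of "norm (G x)" "norm (G x) + norm (G x) * v"]
    by (auto simp: h_def intro!: divide_left_mono)
  have "0 \<le> integral {0..1} h \<and> integral {0..1} h \<le> 1 / ell (norm (G x))"
  proof (cases "h integrable_on {0..1}")
    case True
    then have "0 \<le> integral {0..1} h"
      using h by (intro integral_nonneg) auto
    moreover have "integral {0..1} h \<le> integral {0..1::real} (\<lambda>_. 1 / ell (norm (G x)))"
    proof (rule integral_le[OF True])
      show "(\<lambda>_. 1 / ell (norm (G x))) integrable_on {0..1::real}"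
        by (rule integrable_const_ivl)
    qed (use h in auto)
    ultimately show ?thesis by simp
  next
    case False
    \<comment> \<open>The integral of a non-integrable function is 0 by convention, which also lies
      within the bounds.\<close>
    then show ?thesis using L by (simp add: not_integrable_integral)
  qed
  then show "0 \<le> gd_step ell f x" "gd_step ell f x \<le> 1 / ell (norm (G x))"
    unfolding gd_step_def h_def by auto
qed

lemma gd_iter_closer:
  assumes "\<And>i. i < n \<Longrightarrow> gd_iter ell f x0 i \<in> X"
  shows "norm (gd_iter ell f x0 n - xs) \<le> norm (x0 - xs)"
  using assms
proof (induction n)
  case (Suc n)
  have "norm (gd_iter ell f x0 (Suc n) - xs) \<le> norm (gd_iter ell f x0 n - xs)"
    using step_closer[OF Suc.prems[of n] gd_step_bounds] by simp
  with Suc show ?case by (meson less_Suc_eq order_trans)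
qed simp

section \<open>Phase 2: invariant and iteration count\<close>

text \<open>Admissibility gives \<psi>(\<open>2 * B\<close>) \<ge> \<delta>, while the gap bounds
  \<psi> at the gradient norm by \<delta>; strict monotonicity compares the arguments.\<close>

lemma gradient_le:
  assumes psi: "strict_mono_on {0..} (\<lambda>x. x\<^sup>2 / (2 * ell (4 * x)))"
    and \<delta>: "\<delta> \<in> admissible_delta ell" and x: "x \<in> X" "F x - F xs \<le> \<delta>"
  shows "norm (G x) \<le> 2 * sqrt (\<delta> * ell 0)"
proof (rule ccontr)
  define B where "B = sqrt (\<delta> * ell 0)"
  have \<delta>': "0 \<le> \<delta>" "ell (8 * B) \<le> 2 * ell 0"
    using \<delta> by (auto simp: admissible_delta_def B_def)
  have L: "0 < ell 0" "0 < ell (8 * B)" and B: "0 \<le> B" "B\<^sup>2 = \<delta> * ell 0"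
    using \<delta>' ell_pos[of 0] by (auto simp: B_def intro!: ell_pos)
  have "\<delta> = (2 * B)\<^sup>2 / (2 * (2 * ell 0))"
    using L by (simp add: power_mult_distrib B)
  also have "\<dots> \<le> (2 * B)\<^sup>2 / (2 * ell (4 * (2 * B)))"
    using L \<delta>' by (intro divide_left_mono) auto
  also assume "\<not> norm (G x) \<le> 2 * sqrt (\<delta> * ell 0)"
  then have "(2 * B)\<^sup>2 / (2 * ell (4 * (2 * B))) < (norm (G x))\<^sup>2 / (2 * ell (4 * norm (G x)))"
    using strict_mono_onD[OF psi, of "2 * B" "norm (G x)"] B by (simp add: B_def)
  also have "\<dots> \<le> \<delta>" using gradient_gap[OF x(1)] x(2) by simp
  finally show False by simp
qed

lemma closest_point_closer: "norm (closest_point (closure X) z - xs) \<le> norm (z - xs)"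
proof -
  have xs: "xs \<in> closure X" using xs_in_dom closure_subset by blast
  then have "dist (closest_point (closure X) z) (closest_point (closure X) xs) \<le> dist z xs"
    by (intro closest_point_lipschitz convex_closure convex_dom) auto
  then show ?thesis using xs by (simp add: closest_point_self dist_norm)
qed

text \<open>The Lyapunov bound controls \<open>u\<close> and the gradient at \<open>y\<close>; the
  bound on \<open>norm (y - xs)\<close> is carried along separately. Together they limit
  \<open>y' - y\<close>, so that the inequalities required by \<open>lyapunov_step\<close> hold with
  constant \<open>2 * ell 0\<close>.\<close>

lemma phase2_step:
  assumes psi: "strict_mono_on {0..} (\<lambda>x. x\<^sup>2 / (2 * ell (4 * x)))"
    and \<delta>: "\<delta> \<in> admissible_delta ell" "0 < \<delta>" and R: "0 < R"
    and \<Gamma>: "0 < \<Gamma>" "\<Gamma> \<le> \<delta> / R\<^sup>2"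
    and y: "y \<in> X" "norm (y - xs) \<le> sqrt 2 * R"
    and V: "F y - F xs + \<Gamma> / 2 * (norm (u - xs))\<^sup>2 \<le> R\<^sup>2 * \<Gamma>"
    and \<gamma>: "\<gamma> = 1 / (2 * ell 0)" and a: "a = sqrt (\<gamma> * \<Gamma>)"
    and y': "y' = (1 / (1 + a)) *\<^sub>R y + (a / (1 + a)) *\<^sub>R u - (\<gamma> / (1 + a)) *\<^sub>R G y"
    and u': "u' = closest_point (closure X) (u - (a / \<Gamma>) *\<^sub>R G y')"
  shows "y' \<in> X" "norm (y' - xs) \<le> sqrt 2 * R"
    "F y' - F xs + \<Gamma> / (1 + a) / 2 * (norm (u' - xs))\<^sup>2 \<le> R\<^sup>2 * (\<Gamma> / (1 + a))"
proof -
  define B where "B = sqrt (\<delta> * ell 0)"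
  have L: "0 < ell 0" by (rule ell_pos) simp
  have B: "0 < B" "B\<^sup>2 = \<delta> * ell 0" using \<delta> L by (auto simp: B_def)
  have ell_B: "ell s \<le> 2 * ell 0" if "0 \<le> s" "s \<le> 8 * B" for s
    using ell_mono[OF that] \<delta>(1) by (simp add: admissible_delta_def B_def)
  have \<gamma>_pos: "0 < \<gamma>" using L by (simp add: \<gamma>)
  have a_pos: "0 < a" and a2: "a\<^sup>2 = \<gamma> * \<Gamma>" using \<gamma>_pos \<Gamma> by (auto simp: a)
  have R\<Gamma>: "R\<^sup>2 * \<Gamma> \<le> \<delta>" using \<Gamma>(2) R by (simp add: field_simps)
  have "F y - F xs \<le> \<delta>"
    using V R\<Gamma> \<Gamma>(1) by (smt (verit) divide_nonneg_nonneg mult_nonneg_nonneg zero_le_power2)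
  then have g: "norm (G y) \<le> 2 * B"
    using gradient_le[OF psi \<delta>(1) y(1)] by (simp add: B_def)
  have "\<Gamma> / 2 * (norm (u - xs))\<^sup>2 \<le> \<Gamma> / 2 * (sqrt 2 * R)\<^sup>2"
    using V F_xs_le[OF y(1)] by (simp add: power_mult_distrib mult.commute)
  then have "(norm (u - xs))\<^sup>2 \<le> (sqrt 2 * R)\<^sup>2"
    by (rule mult_left_le_imp_le) (use \<Gamma>(1) in simp)
  then have u: "norm (u - xs) \<le> sqrt 2 * R"
    by (rule power2_le_imp_le) (use R in simp)
  \<comment> \<open>By the choice of \<gamma>, the square of the left side is
    \<open>R\<^sup>2 * \<Gamma> / ell 0\<close>, at most \<open>\<delta> / ell 0\<close>.\<close>
  have "a * (sqrt 2 * R) \<le> B / ell 0"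
  proof (rule power2_le_imp_le)
    have "(a * (sqrt 2 * R))\<^sup>2 = R\<^sup>2 * \<Gamma> / ell 0"
      using L by (simp add: power_mult_distrib a2 \<gamma>)
    also have "\<dots> \<le> \<delta> / ell 0"
      using R\<Gamma> L by (simp add: divide_right_mono)
    also have "\<dots> = (B / ell 0)\<^sup>2"
      using L by (simp add: power_divide B) (simp add: power2_eq_square)
    finally show "(a * (sqrt 2 * R))\<^sup>2 \<le> (B / ell 0)\<^sup>2" .
  qed (use B L in simp)
  then have au: "a * norm (u - xs) \<le> B / ell 0" and ay: "a * norm (y - xs) \<le> B / ell 0"
    using mult_left_mono[OF u, of a] mult_left_mono[OF y(2), of a] a_pos by linarith+
  define w where "w = y' - y"
  have "(1 + a) *\<^sub>R w = a *\<^sub>R (u - xs) - a *\<^sub>R (y - xs) - \<gamma> *\<^sub>R G y"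
    using a_pos by (simp add: w_def y' scaleR_diff_right scaleR_add_right) (simp add: algebra_simps)
  then have "(1 + a) * norm w = norm (a *\<^sub>R (u - xs) - a *\<^sub>R (y - xs) - \<gamma> *\<^sub>R G y)"
    using a_pos by (metis abs_of_pos add_pos_pos norm_scaleR zero_less_one)
  also have "\<dots> \<le> norm (a *\<^sub>R (u - xs)) + norm (a *\<^sub>R (y - xs)) + norm (\<gamma> *\<^sub>R G y)"
    by (meson add_right_mono norm_triangle_ineq4 order_trans)
  also have "\<dots> = a * norm (u - xs) + a * norm (y - xs) + \<gamma> * norm (G y)"
    using a_pos \<gamma>_pos by simp
  also have "\<gamma> * norm (G y) \<le> B / ell 0"
    using g L by (simp add: \<gamma> field_simps)
  finally have "(1 + a) * norm w \<le> 3 * (B / ell 0)"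
    using au ay by simp
  moreover have "norm w \<le> (1 + a) * norm w"
    using a_pos by (simp add: algebra_simps)
  ultimately have "norm w \<le> 3 * (B / ell 0)" by linarith
  then have "2 * ell 0 * norm w \<le> 2 * ell 0 * (3 * (B / ell 0))"
    using L by (intro mult_left_mono) auto
  then have "2 * ell 0 * norm w \<le> 6 * B"
    using L by simp
  \<comment> \<open>The parts from \<open>u\<close>, \<open>y\<close> and the gradient contribute
    \<open>2 * B\<close> each, on top of the \<open>2 * B\<close> of the gradient itself;
    \<open>8 * B\<close> is exactly the argument of \<open>ell\<close> in the admissibility
    condition.\<close>
  then have Gw: "norm (G y) + 2 * ell 0 * norm w \<le> 8 * B"
    using g by linarith
  have yw: "y + w = y'" by (simp add: w_def)
  have loc: "y' \<in> X" "norm (G y' - G y) \<le> 2 * ell 0 * norm w"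
    using local_descent(1,2)[OF y(1) _ ell_B[of "8 * B"] Gw] L B yw by simp_all
  show "y' \<in> X" by (rule loc(1))
  have "norm (G y') \<le> 8 * B"
    using norm_triangle_sub[of "G y'" "G y"] loc(2) Gw by linarith
  then have ell_y': "ell (norm (G y')) \<le> 2 * ell 0" by (intro ell_B) auto
  \<comment> \<open>With \<open>L = 2 * ell 0\<close> the cocoercivity factor
    \<open>1 / (2 * L)\<close> is \<open>\<gamma> / 2\<close>.\<close>
  have interp: "F y' + G y' \<bullet> (y - y') + \<gamma> / 2 * (norm (G y - G y'))\<^sup>2 \<le> F y"
    using cocoercivity[OF loc(1) y(1) ell_B] loc(2) Gw
    by (simp add: \<gamma> norm_minus_commute)
  have interp_min: "F y' + G y' \<bullet> (xs - y') + \<gamma> / 2 * (norm (G y'))\<^sup>2 \<le> F xs"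
    using cocoercivity_at_min[OF loc(1) ell_y'] by (simp add: \<gamma> inner_diff_right)
  have "norm (u' - xs) \<le> norm (u - (a / \<Gamma>) *\<^sub>R G y' - xs)"
    unfolding u' by (rule closest_point_closer)
  from lyapunov_step[OF a_pos \<Gamma>(1) a2 y' interp interp_min this]
  have "(1 + a) * (F y' - F xs) + \<Gamma> / 2 * (norm (u' - xs))\<^sup>2 \<le> R\<^sup>2 * \<Gamma>"
    using V by simp
  then have "((1 + a) * (F y' - F xs) + \<Gamma> / 2 * (norm (u' - xs))\<^sup>2) / (1 + a) \<le> R\<^sup>2 * \<Gamma> / (1 + a)"
    by (rule divide_right_mono) (use a_pos in simp)
  moreover have "((1 + a) * (F y' - F xs) + \<Gamma> / 2 * (norm (u' - xs))\<^sup>2) / (1 + a)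
      = F y' - F xs + \<Gamma> / (1 + a) / 2 * (norm (u' - xs))\<^sup>2"
    using a_pos by (simp add: field_simps)
  ultimately show "F y' - F xs + \<Gamma> / (1 + a) / 2 * (norm (u' - xs))\<^sup>2 \<le> R\<^sup>2 * (\<Gamma> / (1 + a))"
    by (simp only: times_divide_eq_right)
  \<comment> \<open>\<open>y'\<close> is a convex combination of \<open>u\<close> and the gradient
    step \<open>y - \<gamma> *\<^sub>R G y\<close>, and both lie in the ball of radius
    \<open>sqrt 2 * R\<close> around \<open>xs\<close>.\<close>
  have "\<gamma> \<le> 1 / ell (norm (G y))"
    using ell_B[of "norm (G y)"] g B ell_pos[of "norm (G y)"] by (simp add: \<gamma> frac_le)
  then have "norm (y - \<gamma> *\<^sub>R G y - xs) \<le> sqrt 2 * R"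
    using step_closer[OF y(1)] \<gamma>_pos y(2) by (meson order_less_imp_le order_trans)
  then have "y - \<gamma> *\<^sub>R G y \<in> cball xs (sqrt 2 * R)" "u \<in> cball xs (sqrt 2 * R)"
    using u by (auto simp: dist_norm norm_minus_commute)
  then have "(1 / (1 + a)) *\<^sub>R (y - \<gamma> *\<^sub>R G y) + (a / (1 + a)) *\<^sub>R u \<in> cball xs (sqrt 2 * R)"
    using a_pos by (intro convexD[OF convex_cball]) (auto simp: field_simps)
  then show "norm (y' - xs) \<le> sqrt 2 * R"
    by (simp add: y' dist_norm norm_minus_commute algebra_simps)
qed

lemma phase2_invariant:
  assumes psi: "strict_mono_on {0..} (\<lambda>x. x\<^sup>2 / (2 * ell (4 * x)))"
    and \<delta>: "\<delta> \<in> admissible_delta ell" "0 < \<delta>" and R: "0 < R"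
    and x: "x \<in> X" "F x - F xs \<le> \<delta> / 2" "norm (x - xs) \<le> R"
    and "phase2 ell f \<delta> R x k = (y, u, \<Gamma>)"
  shows "0 < \<Gamma> \<and> \<Gamma> \<le> \<delta> / R\<^sup>2 \<and> y \<in> X \<and> norm (y - xs) \<le> sqrt 2 * R
    \<and> F y - F xs + \<Gamma> / 2 * (norm (u - xs))\<^sup>2 \<le> R\<^sup>2 * \<Gamma>"
  using assms(8)
proof (induction k arbitrary: y u \<Gamma>)
  case 0
  \<comment> \<open>Initially the gap and the distance term contribute at most
    \<open>\<delta> / 2\<close> each, and \<open>R\<^sup>2 * \<Gamma>\<close> equals
    \<delta>.\<close>
  have "(norm (x - xs))\<^sup>2 \<le> R\<^sup>2" using x(3) by (rule power_mono) simp
  then have "\<delta> / R\<^sup>2 / 2 * (norm (x - xs))\<^sup>2 \<le> \<delta> / R\<^sup>2 / 2 * R\<^sup>2"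
    using \<delta> by (intro mult_left_mono) auto
  moreover have "1 * R \<le> sqrt 2 * R" using R by (intro mult_right_mono) auto
  ultimately show ?case using 0 \<delta> R x by (auto intro: order_trans)
next
  case (Suc k)
  obtain y0 u0 \<Gamma>0 where k: "phase2 ell f \<delta> R x k = (y0, u0, \<Gamma>0)"
    by (cases "phase2 ell f \<delta> R x k") auto
  note IH = Suc.IH[OF k]
  define \<gamma> where "\<gamma> = 1 / (2 * ell 0)"
  define a where "a = sqrt (\<gamma> * \<Gamma>0)"
  have "0 \<le> a" using IH ell_pos[of 0] by (simp add: a_def \<gamma>_def)
  have eqs: "y = (1 / (1 + a)) *\<^sub>R y0 + (a / (1 + a)) *\<^sub>R u0 - (\<gamma> / (1 + a)) *\<^sub>R G y0"
    "u = closest_point (closure X) (u0 - (a / \<Gamma>0) *\<^sub>R G y)" "\<Gamma> = \<Gamma>0 / (1 + a)"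
    using Suc.prems by (auto simp: k Let_def a_def \<gamma>_def)
  have "\<Gamma> \<le> \<Gamma>0" "0 < \<Gamma>"
    using \<open>0 \<le> a\<close> IH by (auto simp: eqs(3) field_simps)
  then show ?case
    using phase2_step[OF psi \<delta> R _ _ _ _ _ \<gamma>_def a_def eqs(1,2), folded eqs(3)] IH by auto
qed

lemma eps_solution_iff:
  assumes "z \<in> X"
  shows "eps_solution f \<epsilon> z \<longleftrightarrow> F z - F xs \<le> \<epsilon>"
  unfolding eps_solution_def INF_f
  using f_eq[OF assms] f_eq[OF xs_in_dom]
  by (metis ereal_less_eq(3) ereal_minus(1))

text \<open>The rescaled sequence \<open>\<gamma> * \<Gamma>\<close> obeys the recursion of
  \<open>decay_rate\<close>, since \<alpha> is its square root; the target value
  \<open>\<gamma> * (\<epsilon> / R\<^sup>2)\<close> corresponds to a gap of at most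
  \<epsilon>.\<close>

lemma phase2_complexity:
  assumes psi: "strict_mono_on {0..} (\<lambda>x. x\<^sup>2 / (2 * ell (4 * x)))"
    and \<delta>: "\<delta> \<in> admissible_delta ell" "0 < \<delta>" and R: "0 < R" and \<epsilon>: "0 < \<epsilon>"
    and x: "x \<in> X" "F x - F xs \<le> \<delta> / 2" "norm (x - xs) \<le> R"
    and k: "5 * sqrt (ell 0) * R / sqrt \<epsilon>
      + max (1 + log (3 / 2) (\<delta> / (8 * ell 0 * R\<^sup>2)) / 2) 0 \<le> real k"
  shows "fst (phase2 ell f \<delta> R x i) \<in> X" "eps_solution f \<epsilon> (fst (phase2 ell f \<delta> R x k))"
proof -
  \<comment> \<open>The attributes restate the invariant for the projections of the state, without
    naming a triple.\<close>
  note inv = phase2_invariant[OF psi \<delta> R x prod.collapse[symmetric, THEN trans, OF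
        arg_cong2[where f = Pair, OF refl prod.collapse[symmetric]]]]
  define \<gamma> where "\<gamma> = 1 / (2 * ell 0)"
  have L: "0 < ell 0" by (rule ell_pos) simp
  show X: "fst (phase2 ell f \<delta> R x i) \<in> X" for i using inv[of i] by blast
  define s where "s i = \<gamma> * snd (snd (phase2 ell f \<delta> R x i))" for i
  have "s k \<le> \<gamma> * (\<epsilon> / R\<^sup>2)"
  proof (rule decay_rate)
    show "0 < s 0" using L \<delta> R by (simp add: s_def \<gamma>_def)
    show "s (Suc i) = s i / (1 + sqrt (s i))" for i
      by (simp add: s_def \<gamma>_def Let_def split: prod.split)
    show "0 < \<gamma> * (\<epsilon> / R\<^sup>2)" using L \<epsilon> R by (simp add: \<gamma>_def)
    have "5 / sqrt (2 * (\<gamma> * (\<epsilon> / R\<^sup>2))) = 5 * sqrt (ell 0) * R / sqrt \<epsilon>"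
      using L R by (simp add: \<gamma>_def real_sqrt_divide real_sqrt_mult)
    moreover have "s 0 / 4 = \<delta> / (8 * ell 0 * R\<^sup>2)"
      by (simp add: s_def \<gamma>_def)
    ultimately show "5 / sqrt (2 * (\<gamma> * (\<epsilon> / R\<^sup>2))) + max (1 + log (3 / 2) (s 0 / 4) / 2) 0 \<le> real k"
      using k by (simp only:)
  qed
  then have "R\<^sup>2 * snd (snd (phase2 ell f \<delta> R x k)) \<le> \<epsilon>"
    using L R by (simp add: s_def \<gamma>_def field_simps)
  moreover have "F (fst (phase2 ell f \<delta> R x k)) - F xs \<le> R\<^sup>2 * snd (snd (phase2 ell f \<delta> R x k))"
    using inv[of k] by (smt (verit) divide_nonneg_nonneg mult_nonneg_nonneg zero_le_power2)
  ultimately show "eps_solution f \<epsilon> (fst (phase2 ell f \<delta> R x k))"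
    using X eps_solution_iff by simp
qed

text \<open>\<open>k_GD\<close> demands domain membership only of the earlier iterates; the last one
  lies in \<open>X\<close> because its gap to the finite minimum is finite.\<close>

lemma k_GD_finite:
  assumes "k_GD ell f xs x0 \<delta> = enat n"
  shows "gd_iter ell f x0 n \<in> X" "F (gd_iter ell f x0 n) - F xs \<le> \<delta> / 2"
    "norm (gd_iter ell f x0 n - xs) \<le> norm (x0 - xs)"
proof -
  let ?z = "gd_iter ell f x0 n"
  have n: "\<forall>i<n. gd_iter ell f x0 i \<in> X" "f ?z - f xs \<le> ereal (\<delta> / 2)"
    using INF_enat_mem[OF assms[unfolded k_GD_def]] by auto
  show X: "?z \<in> X"
    using n(2) f_eq[OF xs_in_dom] by (cases "f ?z") (auto simp: effdom_def)
  show "F ?z - F xs \<le> \<delta> / 2"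
    using n(2) f_eq[OF X] f_eq[OF xs_in_dom] by (metis ereal_less_eq(3) ereal_minus(1))
  show "norm (?z - xs) \<le> norm (x0 - xs)"
    using n(1) by (intro gd_iter_closer) auto
qed

lemma k_GD_le:
  assumes "\<And>i. i < n \<Longrightarrow> gd_iter ell f x0 i \<in> X" "f (gd_iter ell f x0 n) - f xs \<le> ereal (\<delta> / 2)"
  shows "k_GD ell f xs x0 \<delta> \<le> enat n"
  unfolding k_GD_def using assms by (intro INF_lower) auto

end

section \<open>The choice of \<delta> and the total oracle complexity\<close>

lemma INF_eq_arg_min:
  fixes h :: "'b \<Rightarrow> 'c::complete_linorder"
  assumes "is_arg_min h (\<lambda>x. x \<in> A) x"
  shows "(INF y\<in>A. h y) = h x"
  using assms by (auto simp: is_arg_min_linorder intro!: antisym INF_lower INF_greatest)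

text \<open>The gradient descent count is an integer, so it can be taken out of the rounding and
  only the phase 2 count is rounded up.\<close>

lemma ereal_ceiling_add_nat:
  "ereal_ceiling (ereal r + ereal (real n)) = ereal_ceiling (ereal r) + ereal (real n)"
  using ceiling_add_of_int[of r "int n"] by (simp add: ereal_ceiling_def)

context minimized_ell_smooth
begin

text \<open>The logarithmic term increases with \<open>\<delta>\<close>, so lowering \<open>\<delta>\<close> to the threshold
  \<open>2 * (f z - f xs)\<close> of the gradient descent iterate \<open>z\<close> returned by phase 1 does not increase
  \<open>k_bound\<close>. Finitely many thresholds compete with any finite value of \<open>k_bound\<close>.\<close>

lemma k_bound_attains_min:
  assumes "x0 \<noteq> xs"
  shows "\<exists>\<delta>. is_arg_min (k_bound ell f xs x0) (\<lambda>\<delta>. \<delta> \<in> admissible_delta ell) \<delta>"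
proof -
  let ?K = "k_bound ell f xs x0" and ?k = "k_GD ell f xs x0"
  define thr where "thr n = 2 * (F (gd_iter ell f x0 n) - F xs)" for n
  define c where "c = 8 * ell 0 * (norm (x0 - xs))\<^sup>2"
  have L: "0 < ell 0" by (rule ell_pos) simp
  then have c: "0 < c" using assms by (simp add: c_def)
  have zero: "0 \<in> admissible_delta ell" using L by (simp add: admissible_delta_def)
  have log_mono: "elog (3 / 2) (\<delta> / c) \<le> elog (3 / 2) (\<delta>' / c)" if "0 \<le> \<delta>" "\<delta> \<le> \<delta>'" for \<delta> \<delta>'
    using that c by (auto simp: elog_def divide_right_mono)
  have k_le_K: "ereal_of_enat (?k \<delta>) \<le> ?K \<delta>" for \<delta>
    unfolding k_bound_def by (intro add_increasing) auto
  have lower: "thr n \<in> admissible_delta ell \<and> ?k (thr n) \<le> enat n \<and> ?K (thr n) \<le> ?K \<delta>"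
    if \<delta>: "\<delta> \<in> admissible_delta ell" and n: "?k \<delta> = enat n" for \<delta> n
  proof -
    note fin = k_GD_finite[OF n]
    have thr: "0 \<le> thr n" "thr n \<le> \<delta>"
      using fin(2) F_xs_le[OF fin(1)] by (auto simp: thr_def)
    have "ell (8 * sqrt (thr n * ell 0)) \<le> ell (8 * sqrt (\<delta> * ell 0))"
      using thr L by (intro ell_mono) (auto intro: mult_right_mono)
    then have adm: "thr n \<in> admissible_delta ell"
      using \<delta> thr by (auto simp: admissible_delta_def)
    have k: "?k (thr n) \<le> enat n"
    proof (rule k_GD_le)
      show "gd_iter ell f x0 i \<in> X" if "i < n" for i
        using INF_enat_mem[OF n[unfolded k_GD_def]] that by auto
      show "f (gd_iter ell f x0 n) - f xs \<le> ereal (thr n / 2)"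
        by (subst f_eq[OF fin(1)], subst f_eq[OF xs_in_dom]) (simp add: thr_def)
    qed
    have k': "ereal_of_enat (?k (thr n)) \<le> ereal_of_enat (?k \<delta>)"
      using k n by (simp only: ereal_of_enat_le_iff)
    have "?K (thr n) \<le> ?K \<delta>"
      unfolding k_bound_def c_def[symmetric]
      using k' log_mono[OF thr]
      by (intro add_mono max.mono ereal_mult_left_mono) auto
    with adm k show ?thesis by blast
  qed
  show ?thesis
  proof (cases "\<exists>\<delta>\<in>admissible_delta ell. ?k \<delta> \<noteq> \<infinity>")
    case False
    \<comment> \<open>If phase 1 never succeeds, the bound is constantly \<infinity> and
      \<open>\<delta> = 0\<close> is a minimizer.\<close>
    then have "?K \<delta> = \<infinity>" if "\<delta> \<in> admissible_delta ell" for \<delta>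
      using that k_le_K[of \<delta>] by simp
    with zero show ?thesis by (auto simp: is_arg_min_def)
  next
    case True
    then obtain \<delta>0 n0 where \<delta>0: "\<delta>0 \<in> admissible_delta ell" "?k \<delta>0 = enat n0"
      by auto
    have "?K \<delta>0 \<noteq> \<infinity>"
      using c \<delta>0 by (auto simp: k_bound_def c_def[symmetric] elog_def max_def)
    then obtain N where N: "?K \<delta>0 \<le> ereal (real N)"
      by (metis ereal_less_eq(1) linorder_not_le less_PInf_Ex_of_nat less_le_not_le)
    \<comment> \<open>\<open>k_bound\<close> dominates \<open>k_GD\<close>, so a competitor no worse
      than \<open>\<delta>0\<close> stops phase 1 at an index up to \<open>N\<close>; its threshold
      is then among these.\<close>
    define C where "C = {n. n \<le> N \<and> thr n \<in> admissible_delta ell}"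
    have le_N: "n \<le> N" if "?k \<delta> = enat n" "?K \<delta> \<le> ?K \<delta>0" for \<delta> n
    proof -
      have "ereal (real n) \<le> ereal (real N)"
        using order_trans[OF k_le_K order_trans[OF that(2) N]] that(1) by simp
      then show ?thesis by simp
    qed
    have "finite C" "C \<noteq> {}"
      using lower[OF \<delta>0] le_N[OF \<delta>0(2)] by (auto simp: C_def)
    then obtain m where m: "m \<in> C" "\<And>n. n \<in> C \<Longrightarrow> ?K (thr m) \<le> ?K (thr n)"
      using ex_is_arg_min_if_finite[of C "?K \<circ> thr"] by (auto simp: is_arg_min_linorder)
    have m0: "?K (thr m) \<le> ?K \<delta>0"
      using m(2)[of n0] lower[OF \<delta>0] le_N[OF \<delta>0(2)] by (auto simp: C_def intro: order_trans)
    have "?K (thr m) \<le> ?K \<delta>" if \<delta>: "\<delta> \<in> admissible_delta ell" for \<delta>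
    proof (cases "?K \<delta> \<le> ?K \<delta>0")
      case False
      with m0 show ?thesis by simp
    next
      case True
      have "ereal_of_enat (?k \<delta>) \<le> ?K \<delta>0" using k_le_K True by (rule order_trans)
      then obtain n where n: "?k \<delta> = enat n"
        using \<open>?K \<delta>0 \<noteq> \<infinity>\<close> by (cases "?k \<delta>") auto
      show ?thesis
        using m(2)[of n] lower[OF \<delta> n] le_N[OF n True] by (auto simp: C_def intro: order_trans)
    qed
    with m(1) show ?thesis by (auto simp: is_arg_min_linorder C_def)
  qed
qed

lemma alg1_complexity_le:
  assumes psi: "strict_mono_on {0..} (\<lambda>x. x\<^sup>2 / (2 * ell (4 * x)))"
    and R: "R = norm (x0 - xs)" "0 < R" and \<delta>: "\<delta> \<in> admissible_delta ell" and \<epsilon>: "0 < \<epsilon>"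
  shows "ereal_of_enat (alg1_complexity ell f xs x0 \<delta> R \<epsilon>)
    \<le> ereal_ceiling (ereal (5 * sqrt (ell 0) * R / sqrt \<epsilon>) + k_bound ell f xs x0 \<delta>)"
proof (cases "k_GD ell f xs x0 \<delta>")
  case infinity
  then have "k_bound ell f xs x0 \<delta> = \<infinity>"
    by (simp add: k_bound_def)
  then show ?thesis by (simp add: ereal_ceiling_def)
next
  case (enat n)
  note fin = k_GD_finite[OF enat, folded R(1)]
  define xbar where "xbar = gd_iter ell f x0 n"
  define y where "y k = fst (phase2 ell f \<delta> R xbar k)" for k
  define A where "A = 5 * sqrt (ell 0) * R / sqrt \<epsilon>"
  \<comment> \<open>For \<open>\<delta> = 0\<close> the logarithm is -\<infinity> and the maximum is
    0, whereas \<open>log\<close> alone would give a different value.\<close>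
  define m where "m = (if \<delta> = 0 then 0 else max (1 + log (3 / 2) (\<delta> / (8 * ell 0 * R\<^sup>2)) / 2) 0)"
  define N where "N = nat \<lceil>A + m\<rceil>"
  have L: "0 < ell 0" by (rule ell_pos) simp
  have \<delta>0: "0 \<le> \<delta>" using \<delta> by (simp add: admissible_delta_def)
  have A: "0 \<le> A" and m: "0 \<le> m" using L R \<epsilon> by (auto simp: A_def m_def)
  have "k_bound ell f xs x0 \<delta> = ereal m + ereal (real n)"
    using L R \<delta>0 by (auto simp: k_bound_def enat m_def elog_def R(1)[symmetric] max_def)
  then have rhs: "ereal_ceiling (ereal A + k_bound ell f xs x0 \<delta>) = ereal (real N + real n)"
    using ereal_ceiling_add_nat[of "A + m" n] A m
    by (simp add: add.assoc[symmetric] ereal_ceiling_def N_def)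
  have "\<exists>k\<le>N. (\<forall>i<k. y i \<in> X) \<and> eps_solution f \<epsilon> (y k)"
  proof (cases "\<delta> = 0")
    case True
    \<comment> \<open>With \<open>\<delta> = 0\<close> phase 1 already returns a minimizer, so index
      0 of phase 2 serves.\<close>
    then show ?thesis
      using fin(1,2) \<epsilon> by (intro exI[of _ 0]) (auto simp: y_def xbar_def eps_solution_iff)
  next
    case False
    have "A + m \<le> real N" unfolding N_def by linarith
    then show ?thesis
      using phase2_complexity[OF psi \<delta> _ R(2) \<epsilon> fin, of N] False \<delta>0
      by (intro exI[of _ N]) (auto simp: y_def xbar_def A_def m_def)
  qed
  then have "(INF k\<in>{k. (\<forall>i<k. y i \<in> X) \<and> eps_solution f \<epsilon> (y k)}. enat k) \<le> enat N"
    by (auto intro: INF_lower2)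
  then have "alg1_complexity ell f xs x0 \<delta> R \<epsilon> \<le> enat n + enat N"
    unfolding alg1_complexity_def Let_def enat
    by (simp add: y_def xbar_def add_left_mono del: plus_enat_simps)
  then have "ereal_of_enat (alg1_complexity ell f xs x0 \<delta> R \<epsilon>) \<le> ereal_of_enat (enat (n + N))"
    unfolding ereal_of_enat_le_iff by simp
  then show ?thesis
    unfolding A_def[symmetric] rhs by (simp add: add.commute)
qed

end

theorem corollary3p4:
  fixes f :: "'a::euclidean_space \<Rightarrow> ereal"
    and ell :: "real \<Rightarrow> real"
    and xs x0 :: 'a
    and R :: real
  assumes "\<forall>x. f x \<noteq> -\<infinity>"
    and "open (effdom f)" and "convex (effdom f)" and "effdom f \<noteq> {}"
    and "convex_ext f"
    and "ell_smooth ell f"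
    and "\<forall>x. f xs \<le> f x"
    and "x0 \<in> effdom f"
    and "R = norm (x0 - xs)" and "R > 0"
    and "strict_mono_on {0..} (\<lambda>x. x\<^sup>2 / (2 * ell (4 * x)))"
  shows "(\<exists>\<delta>. is_arg_min (k_bound ell f xs x0) (\<lambda>\<delta>. \<delta> \<in> admissible_delta ell) \<delta>)
    \<and> (\<forall>\<delta>. is_arg_min (k_bound ell f xs x0) (\<lambda>\<delta>. \<delta> \<in> admissible_delta ell) \<delta> \<longrightarrow>
          (\<forall>\<epsilon>>0. ereal_of_enat (alg1_complexity ell f xs x0 \<delta> R \<epsilon>)
             \<le> ereal_ceiling (ereal (5 * sqrt (ell 0) * R / sqrt \<epsilon>)
                  + (INF \<delta>'\<in>admissible_delta ell. k_bound ell f xs x0 \<delta>'))))"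
proof -
  interpret minimized_ell_smooth f ell xs
    using assms by unfold_locales auto
  show ?thesis
  proof (intro conjI allI impI)
    show "\<exists>\<delta>. is_arg_min (k_bound ell f xs x0) (\<lambda>\<delta>. \<delta> \<in> admissible_delta ell) \<delta>"
      using assms(9,10) by (intro k_bound_attains_min) auto
  next
    fix \<delta> \<epsilon> :: real
    assume \<delta>: "is_arg_min (k_bound ell f xs x0) (\<lambda>\<delta>. \<delta> \<in> admissible_delta ell) \<delta>" and "0 < \<epsilon>"
    then show "ereal_of_enat (alg1_complexity ell f xs x0 \<delta> R \<epsilon>)
       \<le> ereal_ceiling (ereal (5 * sqrt (ell 0) * R / sqrt \<epsilon>)
            + (INF \<delta>'\<in>admissible_delta ell. k_bound ell f xs x0 \<delta>'))"
      unfolding INF_eq_arg_min[OF \<delta>]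
      by (intro alg1_complexity_le assms(9-11)) (auto simp: is_arg_min_def)
  qed
qed

end
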